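(* Consider the linear time-varying discrete-time system $x(i+1)=A(i)x(i)$, $x(0)=x_0$, $i=0,1,2,\dots$, with $A(i)\in\mathbb{R}^{n\times n}$, and suppose that it is a totally positive discrete-time system, i.e., $A(i)$ is totally positive for all $i\ge 0$. Then: (i) For any $x_0\in\mathbb{R}^n\setminus\{0\}$ the solution satisfies $s^+(x(i+1))\le s^-(x(i))$ for all $i\ge 0$, and $x(i)\in\mathcal{V}$ for all $i\ge 0$ except perhaps for up to $n-1$ values of $i$. (ii) Let $x_0,\bar x_0\in\mathbb{R}^n$ be two different initial conditions, and let $x(q),\bar x(q)$ denote the corresponding solutions at time $q$. Then there exists $r\ge 0$ such that either $x_1(q)>\bar x_1(q)$ for all $q\ge r$, or $x_1(q)<\bar x_1(q)$ for all $q\ge r$, where the subscript $1$ denotes the first entry of a vector.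
   Context: A matrix is totally positive (TP) if all its minors (of all orders) are positive. For $y\in\mathbb{R}^n$, $s^-(y)$ is the number of sign variations in $y$ after deleting all its zero entries, and $s^+(y)$ is the maximal possible number of sign variations in $y$ after each zero entry is replaced by either $+1$ or $-1$. Define $\mathcal{V}:=\{y\in\mathbb{R}^n: s^-(y)=s^+(y)\}$. *)

theory Defs
  imports
    Complex_Main
    "Jordan_Normal_Form.Matrix"
    "Jordan_Normal_Form.Determinant"
    "Jordan_Normal_Form.DL_Submatrix"
begin

definition totally_positive :: "real mat \<Rightarrow> bool" where
  "totally_positive A \<longleftrightarrow>
    (\<forall>I J. I \<subseteq> {..<dim_row A} \<and> J \<subseteq> {..<dim_col A} \<and> card I = card J \<and> I \<noteq> {}
       \<longrightarrow> det (submatrix A I J) > 0)"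

definition sign_variations :: "real list \<Rightarrow> nat" where
  "sign_variations ys = card {i. Suc i < length ys \<and> ys ! i * ys ! Suc i < 0}"

definition s_minus :: "real vec \<Rightarrow> nat" where
  "s_minus y = sign_variations (filter (\<lambda>a. a \<noteq> 0) (list_of_vec y))"

definition zero_replacements :: "real vec \<Rightarrow> real vec set" where
  "zero_replacements y =
    {z \<in> carrier_vec (dim_vec y).
       \<forall>i<dim_vec y. if y $ i = 0 then z $ i \<in> {1, -1} else z $ i = y $ i}"

(* The maximum is over a finite nonempty set, since zero_replacements y is finite and nonempty. *)
definition s_plus :: "real vec \<Rightarrow> nat" where
  "s_plus y = Max ((\<lambda>z. sign_variations (list_of_vec z)) ` zero_replacements y)"

definition V_set :: "nat \<Rightarrow> real vec set" where
  "V_set n = {y \<in> carrier_vec n. s_minus y = s_plus y}"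

primrec solution :: "(nat \<Rightarrow> real mat) \<Rightarrow> real vec \<Rightarrow> nat \<Rightarrow> real vec" where
  "solution A x0 0 = x0"
| "solution A x0 (Suc i) = A i *\<^sub>v solution A x0 i"

end

theory Submission
  imports Defs "HOL-Library.Sublist"
begin

text \<open>
  The key fact is a sharp form of variation diminution: if \<open>A\<close> is totally positive, \<open>x \<noteq> 0\<close>, and some
  entries of \<open>A x\<close>, from top to bottom, weakly alternate in sign, then equally many entries of \<open>x\<close>
  strictly alternate, starting with the same sign. Adjacent columns belonging to entries of \<open>x\<close> that
  do not have opposite signs can be merged into one column without losing total positivity, since minors
  are linear in each column; this reduces to strictly alternating \<open>x\<close>. There, Cramer's rule with Laplace
  expansion along the first column shows that the first entry of \<open>x\<close> has the sign with which the
  entries of \<open>A x\<close> start, and a sequence that is too long would give this entry both signs.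

  Hence \<open>s\<^sup>-\<close> never increases along a solution, and it drops on reaching any time outside \<open>V\<close>; an
  exceptional initial time is paid for by \<open>s\<^sup>+ \<le> n - 1\<close>. The difference of two
  solutions is again a solution; once it stays in \<open>V\<close> and \<open>s\<^sup>-\<close> is constant along it, its first entry is
  nonzero and, because the starting sign is preserved, keeps its sign.
\<close>

subsection \<open>Sign variations and alternating index sequences\<close>

lemma sign_variations_singleton [simp]: "sign_variations [x] = 0"
  by (simp add: sign_variations_def)

lemma finite_sign_changes: "finite {i. Suc i < length ys \<and> ys ! i * ys ! Suc i < (0::real)}"
  by (rule finite_subset[of _ "{..<length ys}"]) auto

lemma sign_variations_Cons_Cons [simp]:
  "sign_variations (x # y # ys) = of_bool (x * y < 0) + sign_variations (y # ys)"
proof -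
  let ?S = "\<lambda>zs::real list. {i. Suc i < length zs \<and> zs ! i * zs ! Suc i < 0}"
  have "?S (x # y # ys) = {i. i = 0 \<and> x * y < 0} \<union> Suc ` ?S (y # ys)"
  proof (rule Set.set_eqI)
    show "i \<in> ?S (x # y # ys) \<longleftrightarrow> i \<in> {i. i = 0 \<and> x * y < 0} \<union> Suc ` ?S (y # ys)" for i
      by (cases i) auto
  qed
  moreover have "card ({i. i = 0 \<and> x * y < 0} \<union> Suc ` ?S (y # ys))
      = card {i::nat. i = 0 \<and> x * y < 0} + card (Suc ` ?S (y # ys))"
    by (rule card_Un_disjoint) (use finite_sign_changes in auto)
  moreover have "card (Suc ` ?S (y # ys)) = card (?S (y # ys))"
    by (rule card_image) simp
  ultimately show ?thesis
    by (simp add: sign_variations_def)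
qed

lemma sign_variations_Cons:
  "ys \<noteq> [] \<Longrightarrow> sign_variations (x # ys) = of_bool (x * hd ys < 0) + sign_variations ys"
  by (cases ys) auto

lemma subseq_imp_set_subset: "subseq xs ys \<Longrightarrow> set xs \<subseteq> set ys"
  by (induction rule: list_emb.induct) auto

text \<open>The \<open>of_bool\<close> term carries the induction: when \<open>hd us\<close> and
  \<open>hd ys\<close> differ in sign, \<open>ys\<close> has one more sign change on the way to
  \<open>hd us\<close>.\<close>

lemma sign_variations_subseq:
  assumes "subseq us ys" "0 \<notin> set ys" "us \<noteq> []"
  shows "sign_variations us + of_bool (hd us * hd ys < 0) \<le> sign_variations ys"
  using assms
proof (induction us ys)
  case (list_emb_Cons us ys y)
  then have ne: "ys \<noteq> []" by auto
  have "hd us \<in> set ys" "hd ys \<in> set ys"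
    using list_emb_Cons ne by (auto dest!: subseq_imp_set_subset)
  then have "hd us \<noteq> 0" "hd ys \<noteq> 0" "y \<noteq> 0"
    using list_emb_Cons.prems by auto
  then have "of_bool (hd us * y < 0) \<le> of_bool (hd us * hd ys < 0) + (of_bool (y * hd ys < 0) :: nat)"
    by (auto simp: of_bool_def mult_less_0_iff)
  then show ?case
    using list_emb_Cons sign_variations_Cons[OF ne, of y] by simp
next
  case (list_emb_Cons2 u y us ys)
  then have uy: "u = y" by simp
  show ?case
  proof (cases "us = []")
    case True
    then show ?thesis by (simp add: uy mult_less_0_iff)
  next
    case False
    then have ne: "ys \<noteq> []" using list_emb_Cons2 by auto
    have "hd us \<in> set ys" "hd ys \<in> set ys"
      using list_emb_Cons2 ne False by (auto dest!: subseq_imp_set_subset)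
    then have "hd us \<noteq> 0" "hd ys \<noteq> 0" "y \<noteq> 0"
      using list_emb_Cons2.prems by auto
    then have "of_bool (y * hd us < 0) \<le> of_bool (hd us * hd ys < 0) + (of_bool (y * hd ys < 0) :: nat)"
      by (auto simp: of_bool_def mult_less_0_iff)
    then show ?thesis
      using list_emb_Cons2 False sign_variations_Cons[OF ne, of y] sign_variations_Cons[OF False, of y]
      by (simp add: uy not_less)
  qed
qed simp

lemma sign_variations_alternating:
  assumes "\<And>i. i < length us \<Longrightarrow> \<epsilon> * (-1) ^ i * us ! i > (0::real)"
  shows "sign_variations us = length us - 1"
proof -
  have "us ! i * us ! Suc i < 0" if "Suc i < length us" for i
  proof -
    have "0 < \<epsilon> * (-1) ^ i * us ! i" "0 < - (\<epsilon> * (-1) ^ i) * us ! Suc i"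
      using assms[of i] assms[of "Suc i"] that by simp_all
    then show ?thesis
      by (cases "\<epsilon> * (-1) ^ i > 0") (auto simp only: zero_less_mult_iff mult_less_0_iff neg_0_less_iff_less neg_less_0_iff_less)
  qed
  then have "{i. Suc i < length us \<and> us ! i * us ! Suc i < 0} = {..<length us - 1}"
    by auto
  then show ?thesis
    by (simp add: sign_variations_def)
qed

text \<open>Working from the back and prepending an entry only when the next one has the opposite
  sign keeps the last entry of each run of constant sign.\<close>

lemma alternating_subseq_exists:
  assumes "ys \<noteq> []" "0 \<notin> set ys"
  shows "\<exists>us. subseq us ys \<and> length us = Suc (sign_variations ys) \<and>
           (\<forall>i<length us. sgn (hd ys) * (-1) ^ i * us ! i > (0::real))"
  using assms
proof (induction ys)
  case (Cons y ys)
  show ?case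
  proof (cases "ys = []")
    case True
    then show ?thesis
      using Cons.prems by (intro exI[of _ "[y]"]) (auto simp: sgn_real_def)
  next
    case False
    then obtain us where us: "subseq us ys" "length us = Suc (sign_variations ys)"
        "\<And>i. i < length us \<Longrightarrow> sgn (hd ys) * (-1) ^ i * us ! i > 0"
      using Cons by auto
    have "hd ys \<in> set ys" using False by simp
    then have nz: "y \<noteq> 0" "hd ys \<noteq> 0"
      using Cons.prems by auto
    show ?thesis
    proof (cases "y * hd ys < 0")
      case True
      then have sg: "sgn (hd ys) = - sgn y"
        by (auto simp: sgn_real_def mult_less_0_iff)
      have "sgn y * (-1) ^ i * (y # us) ! i > 0" if "i < length (y # us)" for i
        using that us(3)[of "i - 1"] nz sg
        by (cases i) (auto simp: sgn_real_def)
      then show ?thesis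
        using us sign_variations_Cons[OF False, of y] True
        by (intro exI[of _ "y # us"]) auto
    next
      case False
      then have "sgn (hd ys) = sgn y"
        using nz by (auto simp: sgn_real_def mult_less_0_iff)
      then show ?thesis
        using us sign_variations_Cons[OF \<open>ys \<noteq> []\<close>, of y] False
        by (intro exI[of _ us]) auto
    qed
  qed
qed simp

section \<open>Sublists as increasing choices of indices\<close>

lemma subseq_map_nth:
  assumes "strict_mono_on {..<k} f" "\<And>i. i < k \<Longrightarrow> f i < length ys"
  shows "subseq (map (\<lambda>i. ys ! f i) [0..<k]) ys"
  using assms
proof (induction k arbitrary: ys)
  case (Suc k)
  have lt: "f i < f k" if "i < k" for i
    using strict_mono_onD[OF Suc.prems(1)] that by auto
  have "subseq (map (\<lambda>i. take (f k) ys ! f i) [0..<k]) (take (f k) ys)"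
    using Suc.prems lt by (intro Suc.IH) (auto simp: strict_mono_on_def)
  moreover have "map (\<lambda>i. take (f k) ys ! f i) [0..<k] = map (\<lambda>i. ys ! f i) [0..<k]"
    using lt by simp
  moreover have "subseq [ys ! f k] (drop (f k) ys)"
    using Suc.prems(2)[of k] by (simp add: subseq_singleton_left Cons_nth_drop_Suc[symmetric])
  ultimately have "subseq (map (\<lambda>i. ys ! f i) [0..<k] @ [ys ! f k]) (take (f k) ys @ drop (f k) ys)"
    by (metis list_emb_append_mono)
  then show ?case by simp
qed simp

lemma subseq_imp_strict_mono_index:
  assumes "subseq us ys"
  shows "\<exists>f. strict_mono_on {..<length us} f \<and> (\<forall>i<length us. f i < length ys \<and> us ! i = ys ! f i)"
  using assms
proof (induction us ys)
  case (list_emb_Nil ys)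
  then show ?case by (auto simp: strict_mono_on_def)
next
  case (list_emb_Cons us ys y)
  then obtain f where "strict_mono_on {..<length us} f" "\<forall>i<length us. f i < length ys \<and> us ! i = ys ! f i"
    by blast
  then show ?case
    by (intro exI[of _ "Suc \<circ> f"]) (auto simp: strict_mono_on_def)
next
  case (list_emb_Cons2 u y us ys)
  then obtain f where "strict_mono_on {..<length us} f" "\<forall>i<length us. f i < length ys \<and> us ! i = ys ! f i"
    by blast
  with list_emb_Cons2 show ?case
    by (intro exI[of _ "case_nat 0 (Suc \<circ> f)"])
      (auto simp: strict_mono_on_def nth_Cons less_Suc_eq_0_disj split: nat.split)
qed

text \<open>Here \<open>k\<close> counts chosen entries and thus stands for \<open>k - 1\<close>
  sign changes. The starting sign \<epsilon> is recorded because it later decides the sign of the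
  first entry.\<close>

definition alternates :: "real vec \<Rightarrow> real \<Rightarrow> nat \<Rightarrow> bool" where
  "alternates y \<epsilon> k \<longleftrightarrow>
    (\<exists>f. strict_mono_on {..<k} f \<and> (\<forall>i<k. f i < dim_vec y \<and> \<epsilon> * (-1) ^ i * y $ f i > 0))"

definition weakly_alternates :: "real vec \<Rightarrow> real \<Rightarrow> nat \<Rightarrow> bool" where
  "weakly_alternates y \<epsilon> k \<longleftrightarrow>
    (\<exists>f. strict_mono_on {..<k} f \<and> (\<forall>i<k. f i < dim_vec y \<and> \<epsilon> * (-1) ^ i * y $ f i \<ge> 0))"

lemma alternates_imp_weakly_alternates: "alternates y \<epsilon> k \<Longrightarrow> weakly_alternates y \<epsilon> k"
  unfolding alternates_def weakly_alternates_def by (meson less_imp_le)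

lemma strict_mono_on_lessThan_ge:
  assumes "strict_mono_on {..<k} (f :: nat \<Rightarrow> nat)" "i < k"
  shows "i \<le> f i"
  using assms(2)
proof (induction i)
  case (Suc i)
  then have "f i < f (Suc i)" using strict_mono_onD[OF assms(1)] by auto
  with Suc show ?case by auto
qed simp

text \<open>Entry 0 has the wrong sign to open the given choice, so every chosen index is positive
  and 0 can be placed in front.\<close>

lemma alternates_prepend:
  assumes alt: "alternates y \<epsilon> k" and "\<epsilon> * y $ 0 < 0" "dim_vec y > 0"
  shows "alternates y (- \<epsilon>) (Suc k)"
proof -
  obtain f where f: "strict_mono_on {..<k} f"
      "\<And>i. i < k \<Longrightarrow> f i < dim_vec y \<and> \<epsilon> * (-1) ^ i * y $ f i > 0"
    using alt unfolding alternates_def by blast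
  have "f i > 0" if "i < k" for i
    using strict_mono_on_lessThan_ge[OF f(1) that] f(2)[OF that] assms(2)
    by (cases "i = 0"; cases "f i = 0") auto
  then show ?thesis
    unfolding alternates_def using f assms
    by (intro exI[of _ "case_nat 0 f"])
      (auto simp: strict_mono_on_def split: nat.split)
qed

lemma alternates_le_s_minus:
  assumes "alternates y \<epsilon> k"
  shows "k \<le> Suc (s_minus y)"
proof (cases "k = 0")
  case False
  obtain f where f: "strict_mono_on {..<k} f"
      "\<And>i. i < k \<Longrightarrow> f i < dim_vec y \<and> \<epsilon> * (-1) ^ i * y $ f i > 0"
    using assms unfolding alternates_def by blast
  define us where "us = map (\<lambda>i. list_of_vec y ! f i) [0..<k]"
  have us: "length us = k" "\<And>i. i < k \<Longrightarrow> us ! i = y $ f i"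
    by (auto simp: us_def list_of_vec_index f)
  have nz: "0 \<notin> set us"
    using f(2) us by (fastforce simp: in_set_conv_nth)
  have "subseq us (list_of_vec y)"
    unfolding us_def by (rule subseq_map_nth[OF f(1)]) (use f in auto)
  then have "subseq (filter (\<lambda>a. a \<noteq> 0) us) (filter (\<lambda>a. a \<noteq> 0) (list_of_vec y))"
    by (rule subseq_filter)
  moreover have "filter (\<lambda>a. a \<noteq> 0) us = us"
    using nz by (auto simp: filter_id_conv)
  ultimately have "sign_variations us \<le> s_minus y"
    using sign_variations_subseq[of us "filter (\<lambda>a. a \<noteq> 0) (list_of_vec y)"] us False
    unfolding s_minus_def by fastforce
  moreover have "sign_variations us = k - 1"
    using sign_variations_alternating[of us \<epsilon>] us f(2) by auto
  ultimately show ?thesis by linarith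
qed simp

text \<open>Together with \<open>alternates_le_s_minus\<close>, this makes
  \<open>Suc (s_minus y)\<close> the greatest length of an alternating choice of entries of a
  nonzero vector.\<close>

lemma s_minus_alternates:
  assumes "y \<in> carrier_vec n" "y \<noteq> 0\<^sub>v n"
  shows "\<exists>\<epsilon>\<in>{1, -1}. alternates y \<epsilon> (Suc (s_minus y))"
proof -
  define ys where "ys = filter (\<lambda>a. a \<noteq> 0) (list_of_vec y)"
  obtain l where "l < n" "y $ l \<noteq> 0"
    using assms by (metis carrier_vecD eq_vecI index_zero_vec)
  then have "y $ l \<in> set ys"
    using assms(1) by (auto simp: ys_def set_list_of_vec vec_set_def)
  then have ne: "ys \<noteq> []" by auto
  have nz: "0 \<notin> set ys" by (simp add: ys_def)
  obtain us where us: "subseq us ys" "length us = Suc (sign_variations ys)"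
      "\<And>i. i < length us \<Longrightarrow> sgn (hd ys) * (-1) ^ i * us ! i > 0"
    using alternating_subseq_exists[OF ne nz] by blast
  have "subseq us (list_of_vec y)"
    using us(1) by (auto simp: ys_def intro: subseq_order.trans subseq_filter_left)
  then obtain f where f: "strict_mono_on {..<length us} f"
      "\<And>i. i < length us \<Longrightarrow> f i < length (list_of_vec y) \<and> us ! i = list_of_vec y ! f i"
    using subseq_imp_strict_mono_index by blast
  have "alternates y (sgn (hd ys)) (length us)"
    unfolding alternates_def
  proof (intro exI[of _ f] conjI allI impI)
    fix i assume i: "i < length us"
    show "f i < dim_vec y" using f(2)[OF i] by simp
    then show "sgn (hd ys) * (- 1) ^ i * y $ f i > 0" 
      using f(2)[OF i] us(3)[OF i] by (simp add: list_of_vec_index)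
  qed (rule f)
  moreover have "hd ys \<noteq> 0" using ne nz by (metis hd_in_set)
  then have "sgn (hd ys) \<in> {1, -1}" by (auto simp: sgn_real_def)
  ultimately show ?thesis
    using us(2) by (auto simp: s_minus_def ys_def)
qed

section \<open>Zero replacements and \<open>s_plus\<close>\<close>

lemma finite_zero_replacements: "finite (zero_replacements y)"
proof -
  have "list_of_vec ` zero_replacements y
      \<subseteq> {zs. set zs \<subseteq> set (list_of_vec y) \<union> {1, -1} \<and> length zs = dim_vec y}"
  proof clarify
    fix z assume z: "z \<in> zero_replacements y"
    show "set (list_of_vec z) \<subseteq> set (list_of_vec y) \<union> {1, -1} \<and> length (list_of_vec z) = dim_vec y"
      using z unfolding zero_replacements_def
      by (auto simp: set_list_of_vec vec_set_def split: if_splits)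
  qed
  then have "finite (list_of_vec ` zero_replacements y)"
    by (rule finite_subset) (simp add: finite_lists_length_eq)
  then show ?thesis
    by (rule finite_imageD) (metis inj_onI vec_list)
qed

lemma zero_replacements_nonempty: "zero_replacements y \<noteq> {}"
proof -
  have "vec (dim_vec y) (\<lambda>i. if y $ i = 0 then 1 else y $ i) \<in> zero_replacements y"
    by (auto simp: zero_replacements_def)
  then show ?thesis by blast
qed

lemma s_minus_zero_replacement:
  assumes "z \<in> zero_replacements y"
  shows "s_minus z = sign_variations (list_of_vec z)"
proof -
  have "filter (\<lambda>a. a \<noteq> 0) (list_of_vec z) = list_of_vec z"
    using assms by (auto simp: filter_id_conv set_list_of_vec vec_set_def zero_replacements_def split: if_splits)
  then show ?thesis by (simp add: s_minus_def)
qed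

lemma s_minus_le_s_plus_of_replacement:
  assumes "z \<in> zero_replacements y"
  shows "s_minus z \<le> s_plus y"
  unfolding s_plus_def s_minus_zero_replacement[OF assms]
  using assms finite_zero_replacements by (intro Max_ge) auto

lemma s_plus_attained: "\<exists>z \<in> zero_replacements y. s_plus y = s_minus z"
proof -
  have "s_plus y \<in> (\<lambda>z. sign_variations (list_of_vec z)) ` zero_replacements y"
    unfolding s_plus_def
    by (intro Max_in) (simp_all add: finite_zero_replacements zero_replacements_nonempty)
  then show ?thesis by (auto simp: s_minus_zero_replacement)
qed

text \<open>A replacement attaining the maximum has no zero entry, so it has a strictly alternating
  choice. Going back to \<open>y\<close> may turn some chosen entries into zero, which the weak
  inequalities allow.\<close>

lemma s_plus_weakly_alternates:
  assumes "y \<in> carrier_vec n" "n > 0"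
  shows "\<exists>\<epsilon>\<in>{1, -1}. weakly_alternates y \<epsilon> (Suc (s_plus y))"
proof -
  obtain z where z: "z \<in> zero_replacements y" "s_plus y = s_minus z"
    using s_plus_attained by blast
  then have zc: "z \<in> carrier_vec n" "dim_vec z = dim_vec y"
    using assms by (auto simp: zero_replacements_def)
  have "z \<noteq> 0\<^sub>v n"
    using z(1) assms by (auto simp: zero_replacements_def split: if_splits)
  then obtain \<epsilon> where e: "\<epsilon> \<in> {1, -1}" "alternates z \<epsilon> (Suc (s_plus y))"
    using s_minus_alternates[OF zc(1)] z(2) by auto
  then obtain f where f: "strict_mono_on {..<Suc (s_plus y)} f"
    "\<And>i. i < Suc (s_plus y) \<Longrightarrow> f i < dim_vec z \<and> \<epsilon> * (-1) ^ i * z $ f i > 0"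
    unfolding alternates_def by blast
  have "\<epsilon> * (-1) ^ i * y $ f i \<ge> 0" if "i < Suc (s_plus y)" for i
    using f(2)[OF that] z(1) by (cases "y $ f i = 0") (auto simp: zero_replacements_def)
  then show ?thesis
    using e f zc unfolding weakly_alternates_def by metis
qed

lemma alternates_zero_replacement:
  assumes "alternates y \<epsilon> k" "z \<in> zero_replacements y"
  shows "alternates z \<epsilon> k"
proof -
  obtain f where f: "strict_mono_on {..<k} f"
      "\<And>i. i < k \<Longrightarrow> f i < dim_vec y \<and> \<epsilon> * (-1) ^ i * y $ f i > 0"
    using assms(1) unfolding alternates_def by blast
  have "f i < dim_vec z \<and> \<epsilon> * (-1) ^ i * z $ f i > 0" if "i < k" for i
    using f(2)[OF that] assms(2)
    by (cases "y $ f i = 0") (auto simp: zero_replacements_def)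
  with f(1) show ?thesis unfolding alternates_def by blast
qed

lemma s_minus_le_s_plus:
  assumes "y \<in> carrier_vec n" "y \<noteq> 0\<^sub>v n"
  shows "s_minus y \<le> s_plus y"
proof -
  obtain z where "z \<in> zero_replacements y" using zero_replacements_nonempty by blast
  then show ?thesis
    using s_minus_alternates[OF assms] alternates_zero_replacement alternates_le_s_minus
      s_minus_le_s_plus_of_replacement by (meson Suc_le_mono order_trans)
qed

lemma s_minus_le_dim: "s_minus y \<le> dim_vec y - 1"
proof -
  have "s_minus y \<le> length (filter (\<lambda>a. a \<noteq> 0) (list_of_vec y)) - 1"
    unfolding s_minus_def sign_variations_def
    by (rule order_trans[OF card_mono[of "{..<length (filter (\<lambda>a. a \<noteq> 0) (list_of_vec y)) - 1}"]]) auto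
  also have "\<dots> \<le> dim_vec y - 1"
    using length_filter_le[of _ "list_of_vec y"] by (intro diff_le_mono) simp
  finally show ?thesis .
qed

lemma s_plus_le_dim: "s_plus y \<le> dim_vec y - 1"
proof -
  obtain z where "z \<in> zero_replacements y" "s_plus y = s_minus z"
    using s_plus_attained by blast
  then show ?thesis using s_minus_le_dim[of z] by (auto simp: zero_replacements_def)
qed

text \<open>A zero first entry could be replaced by the sign opposite to the start of a longest
  alternating choice. This lengthens the choice by one, so \<open>s_plus\<close> would exceed
  \<open>s_minus\<close>.\<close>

lemma V_set_first_nonzero:
  assumes y: "y \<in> V_set n" "y \<noteq> 0\<^sub>v n"
  shows "y $ 0 \<noteq> 0"
proof
  assume y0: "y $ 0 = 0"
  have yc: "y \<in> carrier_vec n" and eq: "s_minus y = s_plus y"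
    using y by (auto simp: V_set_def)
  obtain \<epsilon> where e: "\<epsilon> \<in> {1, -1}" "alternates y \<epsilon> (Suc (s_minus y))"
    using s_minus_alternates[OF yc y(2)] by blast
  have n: "dim_vec y > 0" using y yc by (cases n) auto
  define z where "z = vec (dim_vec y) (\<lambda>i. if i = 0 then - \<epsilon> else if y $ i = 0 then 1 else y $ i)"
  have z: "z \<in> zero_replacements y"
    using e y0 by (auto simp: z_def zero_replacements_def)
  have "alternates z (- \<epsilon>) (Suc (Suc (s_minus y)))"
    using alternates_zero_replacement[OF e(2) z] e(1) n
    by (intro alternates_prepend) (auto simp: z_def)
  then show False
    using alternates_le_s_minus s_minus_le_s_plus_of_replacement[OF z] eq by fastforce
qed

text \<open>If a longest choice started with the sign opposite to that of entry 0, this entry could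
  be prepended to give a longer one.\<close>

lemma alternates_first_sign:
  assumes y: "y \<in> carrier_vec n" "y \<noteq> 0\<^sub>v n" and y0: "y $ 0 \<noteq> 0"
    and e: "\<epsilon> \<in> {1, -1}"
  shows "alternates y \<epsilon> (Suc (s_minus y)) \<longleftrightarrow> \<epsilon> * y $ 0 > 0"
proof -
  have n: "dim_vec y > 0" using y by (cases n) auto
  have *: "\<delta> * y $ 0 > 0" if "alternates y \<delta> (Suc (s_minus y))" "\<delta> \<in> {1, -1}" for \<delta>
  proof (rule ccontr)
    assume "\<not> \<delta> * y $ 0 > 0"
    then have "\<delta> * y $ 0 < 0" using y0 that(2) by auto
    from alternates_prepend[OF that(1) this n] show False
      using alternates_le_s_minus by fastforce
  qed
  obtain \<delta> where \<delta>: "\<delta> \<in> {1, -1}" "alternates y \<delta> (Suc (s_minus y))"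
    using s_minus_alternates[OF y] by blast
  from *[OF \<delta>(2,1)] have "\<delta> = \<epsilon>" if "\<epsilon> * y $ 0 > 0"
    using that \<delta>(1) e by auto
  then show ?thesis using * e \<delta> by blast
qed

subsection \<open>Variation diminution\<close>

definition minor :: "(nat \<Rightarrow> nat \<Rightarrow> real) \<Rightarrow> nat \<Rightarrow> (nat \<Rightarrow> nat) \<Rightarrow> (nat \<Rightarrow> nat) \<Rightarrow> real" where
  "minor a k r c = det (mat k k (\<lambda>(i, j). a (r i) (c j)))"

text \<open>With index functions instead of index sets, the minors that arise from merging columns
  or deleting a row are given by shifted indices. The case \<open>k = 0\<close> is harmless, as an
  empty determinant is 1, and it serves the cofactors of one-by-one matrices.\<close>

definition positive_minors :: "nat \<Rightarrow> nat \<Rightarrow> (nat \<Rightarrow> nat \<Rightarrow> real) \<Rightarrow> bool" where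
  "positive_minors m n a \<longleftrightarrow>
    (\<forall>k r c. strict_mono_on {..<k} r \<and> (\<forall>i<k. r i < m) \<and>
             strict_mono_on {..<k} c \<and> (\<forall>j<k. c j < n) \<longrightarrow> minor a k r c > 0)"

lemma positive_minorsD:
  assumes "positive_minors m n a"
    and "strict_mono_on {..<k} r" "\<And>i. i < k \<Longrightarrow> r i < m"
    and "strict_mono_on {..<k} c" "\<And>j. j < k \<Longrightarrow> c j < n"
  shows "minor a k r c > 0"
  using assms unfolding positive_minors_def by blast

text \<open>Exactly \<open>i\<close> elements of the image lie below \<open>r i\<close>. This
  translates minors given by index sets into minors given by index functions.\<close>

lemma pick_image_strict_mono:
  assumes r: "strict_mono_on {..<k} r" and "i < k"
  shows "pick (r ` {..<k}) i = r i"
proof -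
  have lt: "r j < r i \<longleftrightarrow> j < i" if "j < k" for j
    using strict_mono_on_less[OF r] that \<open>i < k\<close> by auto
  have "{b \<in> r ` {..<k}. b < r i} = r ` {..<i}"
    using lt \<open>i < k\<close> by (auto 0 4)
  moreover have "inj_on r {..<i}"
    using strict_mono_on_imp_inj_on[OF r] \<open>i < k\<close> by (auto intro: inj_on_subset)
  ultimately have "card {b \<in> r ` {..<k}. b < r i} = i"
    by (simp add: card_image)
  then show ?thesis
    using pick_card_in_set[of "r i" "r ` {..<k}"] \<open>i < k\<close> by auto
qed

lemma totally_positive_imp_positive_minors:
  assumes A: "A \<in> carrier_mat m n" and tp: "totally_positive A"
  shows "positive_minors m n (\<lambda>i j. A $$ (i, j))"
  unfolding positive_minors_def
proof (intro allI impI, elim conjE)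
  fix k :: nat and r c :: "nat \<Rightarrow> nat"
  assume r: "strict_mono_on {..<k} r" "\<forall>i<k. r i < m"
    and c: "strict_mono_on {..<k} c" "\<forall>j<k. c j < n"
  let ?I = "r ` {..<k}" and ?J = "c ` {..<k}"
  have card: "card ?I = k" "card ?J = k"
    using r c by (simp_all add: card_image strict_mono_on_imp_inj_on)
  have "{i. i < m \<and> i \<in> ?I} = ?I" "{j. j < n \<and> j \<in> ?J} = ?J"
    using r c by auto
  then have sub: "submatrix A ?I ?J = mat k k (\<lambda>(i, j). A $$ (r i, c j))"
    using A card r(1) c(1) unfolding submatrix_def
    by (auto intro!: eq_matI simp: pick_image_strict_mono)
  show "minor (\<lambda>i j. A $$ (i, j)) k r c > 0"
  proof (cases "k = 0")
    case True
    then show ?thesis by (simp add: minor_def)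
  next
    case False
    then have "?I \<subseteq> {..<dim_row A} \<and> ?J \<subseteq> {..<dim_col A} \<and> card ?I = card ?J \<and> ?I \<noteq> {}"
      using A r c card by auto
    then have "det (submatrix A ?I ?J) > 0"
      using tp unfolding totally_positive_def by blast
    then show ?thesis by (simp add: sub minor_def)
  qed
qed

text \<open>Cofactors along column \<open>q\<close> ignore the entries of that column, so the three
  matrices share them and the Laplace expansions add up.\<close>

lemma det_column_combination:
  fixes s t :: "'a :: comm_ring_1"
  assumes "A \<in> carrier_mat k k" "B \<in> carrier_mat k k" "C \<in> carrier_mat k k" and q: "q < k"
    and col: "\<And>i. i < k \<Longrightarrow> A $$ (i, q) = s * B $$ (i, q) + t * C $$ (i, q)"
    and eqB: "\<And>i j. i < k \<Longrightarrow> j < k \<Longrightarrow> j \<noteq> q \<Longrightarrow> B $$ (i, j) = A $$ (i, j)"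
    and eqC: "\<And>i j. i < k \<Longrightarrow> j < k \<Longrightarrow> j \<noteq> q \<Longrightarrow> C $$ (i, j) = A $$ (i, j)"
  shows "det A = s * det B + t * det C"
proof -
  have "mat_delete A i q = mat_delete B i q" "mat_delete A i q = mat_delete C i q" if "i < k" for i
    using assms(1-3) eqB eqC that q unfolding mat_delete_def
    by (auto intro!: eq_matI)
  then have cof: "cofactor B i q = cofactor A i q" "cofactor C i q = cofactor A i q" if "i < k" for i
    using that by (simp_all add: cofactor_def)
  show ?thesis
    unfolding laplace_expansion_column[OF assms(1) q] laplace_expansion_column[OF assms(2) q]
      laplace_expansion_column[OF assms(3) q]
    by (simp add: col cof sum_distrib_left sum.distrib[symmetric] algebra_simps)
qed

text \<open>Acts on \<open>y\<close> as \<open>a\<close> acts on the longer vector in which entry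
  \<open>j\<close> of \<open>y\<close> is split into \<open>s * y j\<close> and
  \<open>t * y j\<close>.\<close>

definition merge_columns :: "nat \<Rightarrow> real \<Rightarrow> real \<Rightarrow> (nat \<Rightarrow> nat \<Rightarrow> real) \<Rightarrow> nat \<Rightarrow> nat \<Rightarrow> real" where
  "merge_columns j s t a i l =
    (if l < j then a i l else if l = j then s * a i j + t * a i (Suc j) else a i (Suc l))"

text \<open>A minor through the merged column is \<open>s\<close> times one minor of
  \<open>a\<close> plus \<open>t\<close> times another; every other minor is itself one of
  \<open>a\<close>. Adjacency of the two columns keeps both column choices increasing.\<close>

lemma positive_minors_merge_columns:
  assumes pm: "positive_minors m (Suc n) a" and "j < n" and "s \<ge> 0" "t \<ge> 0" "s + t > 0"
  shows "positive_minors m n (merge_columns j s t a)"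
  unfolding positive_minors_def
proof (intro allI impI, elim conjE)
  fix k :: nat and r c :: "nat \<Rightarrow> nat"
  assume r: "strict_mono_on {..<k} r" "\<forall>i<k. r i < m"
    and c: "strict_mono_on {..<k} c" "\<forall>l<k. c l < n"
  \<comment> \<open>\<open>c1\<close> reads the merged column as column \<open>j\<close>,
    \<open>c2\<close> as column \<open>Suc j\<close>; they agree elsewhere.\<close>
  define c1 where "c1 l = (if c l \<le> j then c l else Suc (c l))" for l
  define c2 where "c2 l = (if c l < j then c l else Suc (c l))" for l
  have c_lt: "c l < c l'" if "l < l'" "l' < k" for l l'
    using strict_mono_onD[OF c(1)] that by auto
  have mono: "strict_mono_on {..<k} c1" "strict_mono_on {..<k} c2"
    using c_lt by (fastforce intro!: strict_mono_onI simp: c1_def c2_def)+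
  have range: "c1 l < Suc n" "c2 l < Suc n" if "l < k" for l
    using c(2) that by (auto simp: c1_def c2_def less_Suc_eq)
  have pos: "minor a k r c1 > 0" "minor a k r c2 > 0"
    using positive_minorsD[OF pm r(1)] r(2) mono range by auto
  show "minor (merge_columns j s t a) k r c > 0"
  proof (cases "\<exists>q<k. c q = j")
    case True
    then obtain q where q: "q < k" "c q = j" by blast
    have other: "c l \<noteq> j" if "l < k" "l \<noteq> q" for l
      using c_lt[of l q] c_lt[of q l] q that by (cases l q rule: linorder_cases) auto
    have "minor (merge_columns j s t a) k r c = s * minor a k r c1 + t * minor a k r c2"
      unfolding minor_def
      by (rule det_column_combination[of _ k _ _ q])
        (use q other in \<open>auto simp: merge_columns_def c1_def c2_def\<close>)
    moreover have "s * minor a k r c1 \<ge> 0" "t * minor a k r c2 \<ge> 0" 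
      using pos assms by auto
    moreover have "s * minor a k r c1 > 0 \<or> t * minor a k r c2 > 0"
      using pos assms by (cases "s = 0") auto
    ultimately show ?thesis by linarith
  next
    case False
    then have "merge_columns j s t a (r i) (c l) = a (r i) (c1 l)" if "l < k" for i l
      using that by (auto simp: merge_columns_def c1_def)
    then have "minor (merge_columns j s t a) k r c = minor a k r c1"
      unfolding minor_def by (intro arg_cong[of _ _ det] eq_matI) auto
    then show ?thesis using pos by simp
  qed
qed

text \<open>Cramer's rule gives \<open>det R = x 0 * det N\<close>. In the expansion of
  \<open>det R\<close> along column 0, the cofactors alternate strictly and the entries weakly, so
  no term has the wrong sign.\<close>

lemma cramer_first_entry:
  assumes pm: "positive_minors m (Suc p) a"
    and r: "strict_mono_on {..<Suc p} r" "\<And>i. i < Suc p \<Longrightarrow> r i < m"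
    and w: "\<And>i. i < Suc p \<Longrightarrow> \<epsilon> * (-1) ^ i * (\<Sum>l<Suc p. a (r i) l * x l) \<ge> 0"
  shows "\<epsilon> * x 0 \<ge> 0"
proof -
  define N where "N = mat (Suc p) (Suc p) (\<lambda>(i, j). a (r i) j)"
  define v where "v = vec (Suc p) x"
  define R where "R = replace_col N (N *\<^sub>v v) 0"
  have N: "N \<in> carrier_mat (Suc p) (Suc p)" and v: "v \<in> carrier_vec (Suc p)"
    by (auto simp: N_def v_def)
  have R: "R \<in> carrier_mat (Suc p) (Suc p)"
    using N by (auto simp: R_def replace_col_def)
  have "minor a (Suc p) r id > 0"
    by (rule positive_minorsD[OF pm r(1)]) (auto simp: r(2) strict_mono_on_def)
  then have detN: "det N > 0"
    by (simp add: minor_def N_def)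
  have R0: "R $$ (i, 0) = (\<Sum>l<Suc p. a (r i) l * x l)" if "i < Suc p" for i
    using that by (simp add: R_def replace_col_def N_def v_def scalar_prod_def lessThan_atLeast0 del: sum.op_ivl_Suc)
  \<comment> \<open>The deleted column is the replaced one, so what remains is a positive minor of
    \<open>a\<close> and the sign comes from the position alone.\<close>
  have cof: "\<exists>d>0. cofactor R i 0 = (-1) ^ i * d" if "i < Suc p" for i
  proof -
    define ri where "ri k = (if k < i then r k else r (Suc k))" for k
    have "mat_delete R i 0 = mat p p (\<lambda>(k, l). a (ri k) (Suc l))"
      using that by (auto intro!: eq_matI simp: mat_delete_def R_def replace_col_def N_def ri_def)
    moreover have "minor a p ri Suc > 0"
    proof (rule positive_minorsD[OF pm])
      show "strict_mono_on {..<p} ri"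
        using strict_mono_onD[OF r(1)] by (auto intro!: strict_mono_onI simp: ri_def)
    qed (auto simp: strict_mono_on_def ri_def r(2))
    ultimately show ?thesis
      by (auto simp: cofactor_def minor_def)
  qed
  have "\<epsilon> * (R $$ (i, 0) * cofactor R i 0) \<ge> 0" if i: "i < Suc p" for i
  proof -
    obtain d where "d > 0" and d: "cofactor R i 0 = (-1) ^ i * d" using cof[OF i] by blast
    then have "0 \<le> d * (\<epsilon> * (-1) ^ i * R $$ (i, 0))"
      using w[OF i] R0[OF i] by simp
    then show ?thesis by (simp add: d mult_ac)
  qed
  then have "0 \<le> \<epsilon> * det R"
    unfolding laplace_expansion_column[OF R zero_less_Suc] sum_distrib_left
    by (intro sum_nonneg) auto
  also have "det R = x 0 * det N"
    using cramer_lemma_mat[OF N v zero_less_Suc] by (simp add: R_def v_def)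
  finally show ?thesis
    using detN by (metis mult.assoc zero_le_mult_iff not_less)
qed

text \<open>Induction on the number of columns. Merging removes columns but no rows, so rectangular
  matrices have to be allowed, and \<open>a\<close> and \<open>x\<close> are generalised because
  both change.\<close>

lemma variation_diminishing:
  assumes "positive_minors m n a"
    and "\<exists>l<n. x l \<noteq> 0"
    and "strict_mono_on {..<k} r" "\<And>i. i < k \<Longrightarrow> r i < m"
    and "\<And>i. i < k \<Longrightarrow> \<epsilon> * (-1) ^ i * (\<Sum>l<n. a (r i) l * x l) \<ge> 0"
    and "\<epsilon> \<in> {1, -1 :: real}"
  shows "\<exists>c. strict_mono_on {..<k} c \<and> (\<forall>i<k. c i < n \<and> \<epsilon> * (-1) ^ i * x (c i) > 0)"
  using assms
proof (induction n arbitrary: a x)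
  case 0
  then show ?case by simp
next
  case (Suc n)
  show ?case
  proof (cases "\<exists>j<n. x j * x (Suc j) \<ge> 0")
    case True
    then obtain j where j: "j < n" "x j * x (Suc j) \<ge> 0" by blast
    \<comment> \<open>The two entries do not have opposite signs: \<open>y j\<close> is their common
      sign, and their absolute values as weights restore them. If both vanish, \<open>y j\<close> is
      0 and any positive weights serve; 1 keeps \<open>s + t > 0\<close>.\<close>
    define s where "s = (if x j = 0 \<and> x (Suc j) = 0 then 1 else \<bar>x j\<bar>)"
    define t where "t = (if x j = 0 \<and> x (Suc j) = 0 then 1 else \<bar>x (Suc j)\<bar>)"
    define y where "y l = (if l < j then x l else if l = j then sgn (x j + x (Suc j)) else x (Suc l))" for l
    have st: "s \<ge> 0" "t \<ge> 0" "s + t > 0"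
      by (auto simp: s_def t_def)
    have sy: "s * y j = x j" "t * y j = x (Suc j)"
      using j(2) by (auto simp: s_def t_def y_def sgn_real_def abs_real_def zero_le_mult_iff)
    have sum_eq: "(\<Sum>l<n. merge_columns j s t a i l * y l) = (\<Sum>l<Suc n. a i l * x l)" for i
    proof -
      obtain d where n: "n = Suc j + d" using j(1) less_iff_Suc_add by auto
      have split: "sum f {..<j + Suc d} = (\<Sum>l<j. f l) + f j + (\<Sum>l<d. f (Suc (j + l)))" for f :: "nat \<Rightarrow> real"
        by (induction d) (auto simp: algebra_simps)
      have split': "sum f {..<j + Suc (Suc d)} = (\<Sum>l<j. f l) + f j + f (Suc j) + (\<Sum>l<d. f (Suc (Suc (j + l))))" for f :: "nat \<Rightarrow> real"
        by (induction d) (auto simp: algebra_simps)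
      have "(s * a i j + t * a i (Suc j)) * y j = a i j * (s * y j) + a i (Suc j) * (t * y j)"
        by (simp add: algebra_simps)
      then have mid: "merge_columns j s t a i j * y j = a i j * x j + a i (Suc j) * x (Suc j)"
        unfolding sy by (simp add: merge_columns_def)
      have "n = j + Suc d" "Suc n = j + Suc (Suc d)" using n by auto
      then show ?thesis
        by (simp only: split split' mid) (simp add: merge_columns_def y_def)
    qed
    obtain l where l: "l < Suc n" "x l \<noteq> 0" using Suc.prems(2) by blast
    have "\<exists>l<n. y l \<noteq> 0"
    proof (cases "x j = 0 \<and> x (Suc j) = 0")
      case True
      then have "l < j \<or> Suc j < l"
        using l by (metis Suc_lessI linorder_neqE_nat)
      then show ?thesis
      proof
        assume "l < j" then show ?thesis using l j by (intro exI[of _ l]) (auto simp: y_def)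
      next
        assume "Suc j < l" then show ?thesis using l j by (intro exI[of _ "l - 1"]) (auto simp: y_def)
      qed
    next
      case False
      then have "y j \<noteq> 0" using sy by auto
      then show ?thesis using j by blast
    qed
    from Suc.IH[OF positive_minors_merge_columns[OF Suc.prems(1) j(1) st] this Suc.prems(3,4) _ Suc.prems(6)]
    obtain c where c: "strict_mono_on {..<k} c"
      and cn: "\<And>i. i < k \<Longrightarrow> c i < n \<and> \<epsilon> * (-1) ^ i * y (c i) > 0"
      unfolding sum_eq using Suc.prems(5) by blast
    \<comment> \<open>Undoing the merge: index \<open>j\<close> goes to whichever of
      \<open>j\<close> and \<open>Suc j\<close> carries the sign of \<open>y j\<close>, namely
      \<open>j\<close> unless \<open>x j = 0\<close>.\<close>
    define c' where "c' i = (if c i < j \<or> (c i = j \<and> x j \<noteq> 0) then c i else Suc (c i))" for i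
    have c_lt: "c i < c i'" if "i < i'" "i' < k" for i i'
      using strict_mono_onD[OF c] that by auto
    have "strict_mono_on {..<k} c'"
      using c_lt by (fastforce intro!: strict_mono_onI simp: c'_def)
    moreover have "c' i < Suc n" if "i < k" for i
      using cn[OF that] by (auto simp: c'_def)
    moreover have "sgn (x (c' i)) = sgn (y (c i))" for i
      using j(2) by (auto simp: c'_def y_def sgn_real_def zero_le_mult_iff)
    then have "\<epsilon> * (-1) ^ i * x (c' i) > 0" if "i < k" for i
      using cn[OF that] by (metis sgn_greater sgn_mult)
    ultimately show ?thesis by blast
  next
    case False
    \<comment> \<open>No pair can be merged, so the whole of \<open>x\<close> alternates
      strictly.\<close>
    then have alt: "x j * x (Suc j) < 0" if "j < n" for j
      using that by (meson not_le)
    have x0: "x 0 \<noteq> 0"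
      using Suc.prems(2) alt[of 0] by (cases "n = 0") auto
    have alt_eps: "\<delta> * (-1) ^ i * x i > 0" if "\<delta> * x 0 > 0" "i \<le> n" for i and \<delta> :: real
      using that(2)
    proof (induction i)
      case (Suc i)
      then have "\<delta> * (-1) ^ i * x i > 0" "x i * x (Suc i) < 0" using alt by auto
      then show ?case
        by (auto simp: zero_less_mult_iff mult_less_0_iff)
    qed (use that in simp)
    \<comment> \<open>A choice of as many rows as columns fixes the sign of \<open>x 0\<close>. The
      sign \<delta> stays free because both starting signs are tried below.\<close>
    have first: "\<delta> * x 0 > 0"
      if "strict_mono_on {..<Suc n} q" "\<And>i. i < Suc n \<Longrightarrow> q i < m"
        "\<And>i. i < Suc n \<Longrightarrow> \<delta> * (-1) ^ i * (\<Sum>l<Suc n. a (q i) l * x l) \<ge> 0" "\<delta> \<in> {1, -1}" for q \<delta>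
      using cramer_first_entry[OF Suc.prems(1) that(1-3)] that(4) x0 by fastforce
    have sm: "strict_mono_on {..<Suc n} r" if "Suc n \<le> k"
      using Suc.prems(3) that by (auto simp: strict_mono_on_def)
    show ?thesis
    proof (cases "k \<le> n")
      case True
      \<comment> \<open>There are \<open>n + 1\<close> alternating entries, so \<open>k\<close> of
        them can start at index 0 or at index 1, whichever has sign \<epsilon>.\<close>
      show ?thesis
      proof (cases "\<epsilon> * x 0 > 0")
        case True
        then show ?thesis
          using alt_eps[OF True] \<open>k \<le> n\<close>
          by (intro exI[of _ id]) (auto simp: strict_mono_on_def)
      next
        case False
        then have "- \<epsilon> * x 0 > 0"
          using x0 Suc.prems(6) by auto
        then have "\<epsilon> * (-1) ^ i * x (Suc i) > 0" if "i < k" for i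
          using alt_eps[of "- \<epsilon>" "Suc i"] \<open>k \<le> n\<close> that by simp
        then show ?thesis
          using \<open>k \<le> n\<close> by (intro exI[of _ Suc]) (auto simp: strict_mono_on_def)
      qed
    next
      case False
      then have *: "\<epsilon> * x 0 > 0"
        using Suc.prems sm by (intro first[of r]) auto
      have "k \<le> Suc n"
      proof (rule ccontr)
        assume "\<not> k \<le> Suc n"
        \<comment> \<open>With at least \<open>n + 2\<close> rows, dropping the first leaves a
          choice that starts with the opposite sign, and this forces the opposite sign on
          \<open>x 0\<close>.\<close>
        have "- \<epsilon> * x 0 > 0"
        proof (rule first[of "r \<circ> Suc"])
          show "strict_mono_on {..<Suc n} (r \<circ> Suc)"
            using \<open>\<not> k \<le> Suc n\<close> Suc.prems(3) by (auto simp: strict_mono_on_def)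
          show "0 \<le> - \<epsilon> * (-1) ^ i * (\<Sum>l<Suc n. a ((r \<circ> Suc) i) l * x l)" if "i < Suc n" for i
            using Suc.prems(5)[of "Suc i"] that \<open>\<not> k \<le> Suc n\<close> by simp
        qed (use Suc.prems \<open>\<not> k \<le> Suc n\<close> in auto)
        with * show False by simp
      qed
      then show ?thesis
        using alt_eps[OF *] by (intro exI[of _ id]) (auto simp: strict_mono_on_def)
    qed
  qed
qed

subsection \<open>Totally positive discrete-time systems\<close>

lemma alternates_of_weakly_alternates_mult:
  assumes A: "A \<in> carrier_mat m n" and tp: "totally_positive A"
    and x: "x \<in> carrier_vec n" "x \<noteq> 0\<^sub>v n"
    and e: "\<epsilon> \<in> {1, -1}" and w: "weakly_alternates (A *\<^sub>v x) \<epsilon> k"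
  shows "alternates x \<epsilon> k"
proof -
  obtain r where r: "strict_mono_on {..<k} r"
      "\<And>i. i < k \<Longrightarrow> r i < m \<and> \<epsilon> * (-1) ^ i * (A *\<^sub>v x) $ r i \<ge> 0"
    using w A unfolding weakly_alternates_def by auto
  have "\<exists>l<n. x $ l \<noteq> 0"
    using x by (metis carrier_vecD eq_vecI index_zero_vec)
  moreover have "(A *\<^sub>v x) $ i = (\<Sum>l<n. A $$ (i, l) * x $ l)" if "i < m" for i
    using A x that by (simp add: scalar_prod_def lessThan_atLeast0)
  moreover from this have "\<epsilon> * (-1) ^ i * (\<Sum>l<n. A $$ (r i, l) * x $ l) \<ge> 0" if "i < k" for i
    using that r(2)[OF that] by metis
  ultimately obtain c where "strict_mono_on {..<k} c"
      "\<forall>i<k. c i < n \<and> \<epsilon> * (-1) ^ i * x $ c i > 0"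
    using variation_diminishing[OF totally_positive_imp_positive_minors[OF A tp], of "\<lambda>l. x $ l" k r \<epsilon>]
      r e by blast
  then show ?thesis
    using x unfolding alternates_def by auto
qed

text \<open>A weakly alternating choice in the image, with one entry more than its
  \<open>s_plus\<close>, pulls back to a strictly alternating choice in \<open>x\<close> of the same
  length.\<close>

lemma s_plus_mult_le_s_minus:
  assumes "A \<in> carrier_mat m n" "totally_positive A" "x \<in> carrier_vec n" "x \<noteq> 0\<^sub>v n" "m > 0"
  shows "s_plus (A *\<^sub>v x) \<le> s_minus x"
proof -
  have "A *\<^sub>v x \<in> carrier_vec m" using assms by simp
  from s_plus_weakly_alternates[OF this \<open>m > 0\<close>] obtain \<epsilon> where
    "\<epsilon> \<in> {1, -1}" "weakly_alternates (A *\<^sub>v x) \<epsilon> (Suc (s_plus (A *\<^sub>v x)))"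
    by blast
  then show ?thesis
    using alternates_le_s_minus[OF alternates_of_weakly_alternates_mult[OF assms(1-4)]] by fastforce
qed

lemma totally_positive_mult_nonzero:
  assumes A: "A \<in> carrier_mat n n" and tp: "totally_positive A"
    and x: "x \<in> carrier_vec n" "x \<noteq> 0\<^sub>v n"
  shows "A *\<^sub>v x \<noteq> 0\<^sub>v n"
proof -
  have "minor (\<lambda>i j. A $$ (i, j)) n id id > 0"
    by (rule positive_minorsD[OF totally_positive_imp_positive_minors[OF A tp]])
      (auto simp: strict_mono_on_def)
  moreover have "mat n n (\<lambda>(i, j). A $$ (id i, id j)) = A"
    using A by auto
  ultimately have "det A \<noteq> 0" by (simp add: minor_def)
  then show ?thesis
    using det_0_iff_vec_prod_zero[OF A] x by blast
qed

text \<open>Equality of \<open>s_minus\<close> lets a longest choice in the image pull back to a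
  longest choice in \<open>x\<close> with the same starting sign. By
  \<open>alternates_first_sign\<close>, these starting signs are the signs of the first
  entries.\<close>

lemma first_entry_sign_preserved:
  assumes A: "A \<in> carrier_mat n n" "totally_positive A"
    and x: "x \<in> carrier_vec n" "x \<noteq> 0\<^sub>v n" "x $ 0 \<noteq> 0"
    and Ax: "(A *\<^sub>v x) $ 0 \<noteq> 0" and eq: "s_minus (A *\<^sub>v x) = s_minus x"
  shows "sgn ((A *\<^sub>v x) $ 0) = sgn (x $ 0)"
proof -
  define \<epsilon> where "\<epsilon> = sgn ((A *\<^sub>v x) $ 0)"
  have e: "\<epsilon> \<in> {1, -1}" "\<epsilon> * (A *\<^sub>v x) $ 0 > 0"
    using Ax by (auto simp: \<epsilon>_def sgn_real_def)
  have c: "A *\<^sub>v x \<in> carrier_vec n" using A x by simp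
  from alternates_first_sign[OF c totally_positive_mult_nonzero[OF A x(1,2)] Ax e(1)] e(2)
  have "alternates (A *\<^sub>v x) \<epsilon> (Suc (s_minus x))"
    by (simp add: eq)
  then have "alternates x \<epsilon> (Suc (s_minus x))"
    using alternates_of_weakly_alternates_mult[OF A x(1,2) e(1)] alternates_imp_weakly_alternates by blast
  then have "\<epsilon> * x $ 0 > 0"
    using alternates_first_sign[OF x e(1)] by simp
  then show ?thesis
    using e(1) unfolding \<epsilon>_def[symmetric] by (auto simp: sgn_real_def)
qed

lemma nonzero_vec_dim_pos: "v \<in> carrier_vec n \<Longrightarrow> v \<noteq> 0\<^sub>v n \<Longrightarrow> n > 0"
  by (cases n) auto

section \<open>Solutions of the time-varying system\<close>

context
  fixes n :: nat and A :: "nat \<Rightarrow> real mat"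
  assumes A: "\<And>i. A i \<in> carrier_mat n n" and tp: "\<And>i. totally_positive (A i)"
begin

lemma solution_carrier: "x0 \<in> carrier_vec n \<Longrightarrow> solution A x0 i \<in> carrier_vec n"
  by (induction i) (use A in \<open>auto intro: mult_mat_vec_carrier\<close>)

lemma solution_diff:
  assumes "x0 \<in> carrier_vec n" "x0' \<in> carrier_vec n"
  shows "solution A (x0 - x0') i = solution A x0 i - solution A x0' i"
  using assms
  by (induction i) (auto simp: mult_minus_distrib_mat_vec[OF A] solution_carrier)

context
  fixes x0 :: "real vec"
  assumes x0: "x0 \<in> carrier_vec n" "x0 \<noteq> 0\<^sub>v n"
begin

lemma solution_nonzero: "solution A x0 i \<noteq> 0\<^sub>v n"
  by (induction i) (simp_all add: x0 totally_positive_mult_nonzero[OF A tp] solution_carrier)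

lemma s_plus_solution_Suc_le: "s_plus (solution A x0 (Suc i)) \<le> s_minus (solution A x0 i)"
  using s_plus_mult_le_s_minus[OF A tp solution_carrier[OF x0(1)] solution_nonzero nonzero_vec_dim_pos[OF x0]] by simp

lemma s_minus_le_s_plus_solution: "s_minus (solution A x0 i) \<le> s_plus (solution A x0 i)"
  by (rule s_minus_le_s_plus[OF solution_carrier[OF x0(1)] solution_nonzero])

lemma s_minus_solution_decseq: "decseq (\<lambda>i. s_minus (solution A x0 i))"
  by (intro decseq_SucI order_trans[OF s_minus_le_s_plus_solution s_plus_solution_Suc_le])

lemma exceptional_times:
  "finite {i. solution A x0 i \<notin> V_set n} \<and> card {i. solution A x0 i \<notin> V_set n} \<le> n - 1"
proof -
  let ?E = "{i. solution A x0 i \<notin> V_set n}"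
  have exc: "s_minus (solution A x0 i) < s_plus (solution A x0 i)" if "i \<in> ?E" for i
    using that s_minus_le_s_plus_solution[of i] solution_carrier[OF x0(1), of i]
    by (auto simp: V_set_def)
  \<comment> \<open>Exceptional times so far and remaining sign changes share the budget
    \<open>n - 1\<close>: each newly reached exceptional time uses up at least one sign
    change.\<close>
  have count: "card (?E \<inter> {..N}) + s_minus (solution A x0 N) \<le> n - 1" for N
  proof (induction N)
    case 0
    have "s_plus (solution A x0 0) \<le> n - 1"
      using s_plus_le_dim[of "solution A x0 0"] solution_carrier[OF x0(1), of 0] by simp
    moreover have "?E \<inter> {..0} = (if 0 \<in> ?E then {0} else {})" by auto
    ultimately show ?case
      using exc[of 0] s_minus_le_s_plus_solution[of 0] by (auto split: if_splits)
  next
    case (Suc N)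
    have "?E \<inter> {..Suc N} = (if Suc N \<in> ?E then insert (Suc N) (?E \<inter> {..N}) else ?E \<inter> {..N})"
      by (auto simp: le_Suc_eq)
    then have "card (?E \<inter> {..Suc N}) = card (?E \<inter> {..N}) + of_bool (Suc N \<in> ?E)"
      by simp
    then show ?case
      using Suc exc[of "Suc N"] s_minus_le_s_plus_solution[of "Suc N"] s_plus_solution_Suc_le[of N]
      by (cases "Suc N \<in> ?E") auto
  qed
  \<comment> \<open>Every finite set of exceptional times lies in an initial segment, so the bound
    for all \<open>N\<close> yields finiteness and cardinality together.\<close>
  show ?thesis
  proof (rule finite_if_finite_subsets_card_bdd)
    fix G assume G: "G \<subseteq> ?E" "finite G"
    then have "G \<subseteq> ?E \<inter> {..Max G}" by auto
    then have "card G \<le> card (?E \<inter> {..Max G})" by (intro card_mono) auto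
    also have "\<dots> \<le> n - 1" using count[of "Max G"] by linarith
    finally show "card G \<le> n - 1" .
  qed
qed

lemma first_entry_eventually_constant_sign:
  "\<exists>r. (\<forall>q\<ge>r. solution A x0 q $ 0 > 0) \<or> (\<forall>q\<ge>r. solution A x0 q $ 0 < 0)"
proof -
  obtain r0 where r0: "\<And>q. q \<ge> r0 \<Longrightarrow> solution A x0 q \<in> V_set n"
    using exceptional_times finite_nat_set_iff_bounded
    by (metis (mono_tags, lifting) mem_Collect_eq not_le)
  \<comment> \<open>A nonincreasing sequence is constant from a minimum on; the minimum is taken
    over times from which the solution stays in \<open>V_set n\<close>.\<close>
  obtain r where r: "r \<ge> r0"
    and min: "\<And>q. q \<ge> r0 \<Longrightarrow> s_minus (solution A x0 r) \<le> s_minus (solution A x0 q)"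
    using ex_has_least_nat[of "\<lambda>q. q \<ge> r0" r0 "\<lambda>q. s_minus (solution A x0 q)"] by blast
  have const: "s_minus (solution A x0 q) = s_minus (solution A x0 r)" if "q \<ge> r" for q
    using decseqD[OF s_minus_solution_decseq that] min[of q] r that by simp
  have nz: "solution A x0 q $ 0 \<noteq> 0" if "q \<ge> r" for q
    using V_set_first_nonzero[OF r0 solution_nonzero] r that by simp
  have "sgn (solution A x0 q $ 0) = sgn (solution A x0 r $ 0)" if "q \<ge> r" for q
    using that
  proof (induction q rule: dec_induct)
    case (step q)
    have "sgn ((A q *\<^sub>v solution A x0 q) $ 0) = sgn (solution A x0 q $ 0)"
      using nz[of q] nz[of "Suc q"] const[of q] const[of "Suc q"] step.hyps
      by (intro first_entry_sign_preserved[OF A tp solution_carrier[OF x0(1)] solution_nonzero]) auto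
    then show ?case using step.IH by simp
  qed simp
  then have "\<forall>q\<ge>r. solution A x0 q $ 0 > 0" if "solution A x0 r $ 0 > 0"
    using that by (metis sgn_greater)
  moreover have "\<forall>q\<ge>r. solution A x0 q $ 0 < 0" if "solution A x0 r $ 0 < 0"
    using that \<open>\<And>q. q \<ge> r \<Longrightarrow> sgn (solution A x0 q $ 0) = sgn (solution A x0 r $ 0)\<close>
    by (metis sgn_less)
  ultimately show ?thesis
    using nz[of r] by (meson linorder_neqE order_refl)
qed

end

end

theorem theorem6:
  fixes n :: nat and A :: "nat \<Rightarrow> real mat"
  assumes "\<And>i. A i \<in> carrier_mat n n"
    and "\<And>i. totally_positive (A i)"
  shows "(\<forall>x0 \<in> carrier_vec n - {0\<^sub>v n}.
            (\<forall>i. s_plus (solution A x0 (i + 1)) \<le> s_minus (solution A x0 i)) \<and>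
            finite {i. solution A x0 i \<notin> V_set n} \<and>
            card {i. solution A x0 i \<notin> V_set n} \<le> n - 1) \<and>
         (\<forall>x0 \<in> carrier_vec n. \<forall>x0' \<in> carrier_vec n. x0 \<noteq> x0' \<longrightarrow>
            (\<exists>r. (\<forall>q\<ge>r. solution A x0 q $ 0 > solution A x0' q $ 0) \<or>
                 (\<forall>q\<ge>r. solution A x0 q $ 0 < solution A x0' q $ 0)))"
proof (intro conjI ballI impI)
  fix x0 :: "real vec"
  assume "x0 \<in> carrier_vec n - {0\<^sub>v n}"
  then have x0: "x0 \<in> carrier_vec n" "x0 \<noteq> 0\<^sub>v n" by auto
  show "\<forall>i. s_plus (solution A x0 (i + 1)) \<le> s_minus (solution A x0 i)"
    using s_plus_solution_Suc_le[where A = A, OF assms x0] by simp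
  show "finite {i. solution A x0 i \<notin> V_set n}" "card {i. solution A x0 i \<notin> V_set n} \<le> n - 1"
    using exceptional_times[where A = A, OF assms x0] by auto
next
  fix x0 x0' :: "real vec"
  assume c: "x0 \<in> carrier_vec n" "x0' \<in> carrier_vec n" and "x0 \<noteq> x0'"
  have d: "x0 - x0' \<in> carrier_vec n" using c by simp
  have "x0 - x0' \<noteq> 0\<^sub>v n"
  proof
    assume *: "x0 - x0' = 0\<^sub>v n"
    have "x0 = x0'"
    proof (rule eq_vecI)
      fix i assume i: "i < dim_vec x0'"
      then show "x0 $ i = x0' $ i"
        using arg_cong[OF *, of "\<lambda>v. v $ i"] c by simp
    qed (use c in simp)
    with \<open>x0 \<noteq> x0'\<close> show False ..
  qed
  note z = d this
  \<comment> \<open>Different initial vectors force \<open>n > 0\<close>, so index 0 is in range and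
    subtraction is entrywise there.\<close>
  have "solution A (x0 - x0') q $ 0 = solution A x0 q $ 0 - solution A x0' q $ 0" for q
    using nonzero_vec_dim_pos[OF z] solution_diff[where A = A, OF assms c] solution_carrier[where A = A, OF assms c(2), of q]
    by simp
  then show "\<exists>r. (\<forall>q\<ge>r. solution A x0 q $ 0 > solution A x0' q $ 0) \<or>
                 (\<forall>q\<ge>r. solution A x0 q $ 0 < solution A x0' q $ 0)"
    using first_entry_eventually_constant_sign[where A = A, OF assms z] by simp
qed

end
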